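(* Let $D\subset\mathbb{R}^d$ be a nonempty bounded open set, let $f\colon L^2(D)\to\mathbb{R}$ be continuously differentiable, let $x_a,x_b\in L^2(D)$ satisfy $x_a(\omega)<0<x_b(\omega)$ for almost every $\omega\in D$, and put $$\varphi(x):=\boldsymbol\lambda(\{x\ne0\})\quad(x\in L^2(D)),\qquad \Omega:=\{x\in L^2(D)\mid x_a\le x\le x_b\text{ a.e. on }D\}.$$ Let $\bar x\in L^2(D)$ be a local minimum of the problem $\min\{f(x)+\varphi(x)\mid x\in\Omega\}$. Then $$f'(\bar x)=0\ \text{ a.e. on }\{\bar x\ne0\}\cap\{x_a<\bar x<x_b\},\qquad f'(\bar x)\ge0\ \text{ a.e. on }\{\bar x=x_a\},\qquad f'(\bar x)\le0\ \text{ a.e. on }\{\bar x=x_b\}.$$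
   Context: $\boldsymbol\lambda$ is Lebesgue measure on $D$; $L^2(D)$ is the usual Lebesgue space with its usual norm, and its dual is identified with $L^2(D)$, so $f'(\bar x)\in L^2(D)$ is a function on $D$. For $x\in L^2(D)$, $\{x\ne0\}:=\{\omega\in D\mid x(\omega)\ne0\}$, and $\{x_a<x<x_b\}$, $\{x=x_a\}$, etc. are defined analogously (up to null sets). *)

theory Defs
  imports "HOL-Analysis.Analysis"
begin

(* The library has no Lebesgue space type over a set D.  Elements of L^2(D) are given by
   representatives, i.e. square integrable functions; only their values on D matter, and functions
   equal a.e. on D denote the same element.  Sums and differences of elements are written
   pointwise. *)

definition L2 :: "'a::euclidean_space set \<Rightarrow> ('a \<Rightarrow> real) set" where
  "L2 D = {x \<in> borel_measurable (lebesgue_on D). integrable (lebesgue_on D) (\<lambda>\<omega>. (x \<omega>)\<^sup>2)}"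

definition norm_L2 :: "'a::euclidean_space set \<Rightarrow> ('a \<Rightarrow> real) \<Rightarrow> real" where
  "norm_L2 D x = sqrt (LINT \<omega>|lebesgue_on D. (x \<omega>)\<^sup>2)"

(* "f is a map from L^2(D) to the reals": f does not depend on the chosen representative. *)
definition functional_on_L2 :: "'a::euclidean_space set \<Rightarrow> (('a \<Rightarrow> real) \<Rightarrow> real) \<Rightarrow> bool" where
  "functional_on_L2 D f \<longleftrightarrow>
     (\<forall>x\<in>L2 D. \<forall>y\<in>L2 D. (AE \<omega> in lebesgue_on D. x \<omega> = y \<omega>) \<longrightarrow> f x = f y)"

(* The topological dual: bounded linear functionals on L^2(D), in the seminorm norm_L2.
   Boundedness implies independence of the representative. *)
definition dual_L2 :: "'a::euclidean_space set \<Rightarrow> (('a \<Rightarrow> real) \<Rightarrow> real) set" where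
  "dual_L2 D = {l.
     (\<forall>h\<in>L2 D. \<forall>k\<in>L2 D. l (\<lambda>\<omega>. h \<omega> + k \<omega>) = l h + l k) \<and>
     (\<forall>c. \<forall>h\<in>L2 D. l (\<lambda>\<omega>. c * h \<omega>) = c * l h) \<and>
     (\<exists>C. \<forall>h\<in>L2 D. \<bar>l h\<bar> \<le> C * norm_L2 D h)}"

definition dual_norm_L2 :: "'a::euclidean_space set \<Rightarrow> (('a \<Rightarrow> real) \<Rightarrow> real) \<Rightarrow> real" where
  "dual_norm_L2 D l = (SUP h\<in>{h \<in> L2 D. norm_L2 D h \<le> 1}. \<bar>l h\<bar>)"

(* The identification of L^2(D) with its dual. *)
definition L2_to_dual ::
    "'a::euclidean_space set \<Rightarrow> ('a \<Rightarrow> real) \<Rightarrow> ('a \<Rightarrow> real) \<Rightarrow> real" where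
  "L2_to_dual D g = (\<lambda>h. LINT \<omega>|lebesgue_on D. g \<omega> * h \<omega>)"

(* Frechet differentiability at x with derivative l. *)
definition has_L2_derivative ::
    "'a::euclidean_space set \<Rightarrow> (('a \<Rightarrow> real) \<Rightarrow> real) \<Rightarrow> (('a \<Rightarrow> real) \<Rightarrow> real) \<Rightarrow>
     ('a \<Rightarrow> real) \<Rightarrow> bool" where
  "has_L2_derivative D f l x \<longleftrightarrow> l \<in> dual_L2 D \<and>
     (\<forall>\<epsilon>>0. \<exists>\<delta>>0. \<forall>h\<in>L2 D. norm_L2 D h < \<delta> \<longrightarrow>
        \<bar>f (\<lambda>\<omega>. x \<omega> + h \<omega>) - f x - l h\<bar> \<le> \<epsilon> * norm_L2 D h)"

definition continuously_differentiable_L2 ::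
    "'a::euclidean_space set \<Rightarrow> (('a \<Rightarrow> real) \<Rightarrow> real) \<Rightarrow> bool" where
  "continuously_differentiable_L2 D f \<longleftrightarrow>
     (\<exists>f'. (\<forall>x\<in>L2 D. has_L2_derivative D f (f' x) x) \<and>
       (\<forall>x\<in>L2 D. \<forall>\<epsilon>>0. \<exists>\<delta>>0. \<forall>y\<in>L2 D. norm_L2 D (\<lambda>\<omega>. y \<omega> - x \<omega>) < \<delta> \<longrightarrow>
          dual_norm_L2 D (\<lambda>h. f' y h - f' x h) < \<epsilon>))"

definition support_measure :: "'a::euclidean_space set \<Rightarrow> ('a \<Rightarrow> real) \<Rightarrow> real" where
  "support_measure D x = measure lebesgue {\<omega> \<in> D. x \<omega> \<noteq> 0}"

definition L2_box ::
    "'a::euclidean_space set \<Rightarrow> ('a \<Rightarrow> real) \<Rightarrow> ('a \<Rightarrow> real) \<Rightarrow> ('a \<Rightarrow> real) set" where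
  "L2_box D a b = {x \<in> L2 D. AE \<omega> in lebesgue_on D. a \<omega> \<le> x \<omega> \<and> x \<omega> \<le> b \<omega>}"

definition local_min_L2 ::
    "'a::euclidean_space set \<Rightarrow> (('a \<Rightarrow> real) \<Rightarrow> real) \<Rightarrow> ('a \<Rightarrow> real) set \<Rightarrow> ('a \<Rightarrow> real) \<Rightarrow> bool" where
  "local_min_L2 D F S x \<longleftrightarrow> x \<in> S \<and>
     (\<exists>\<epsilon>>0. \<forall>y\<in>S. norm_L2 D (\<lambda>\<omega>. y \<omega> - x \<omega>) < \<epsilon> \<longrightarrow> F x \<le> F y)"

end

theory Submission
  imports Defs
begin

text \<open>
  The support term \<open>\<phi>\<close> is only lower semicontinuous, but it cannot increase along a perturbation that
  vanishes wherever \<open>xbar\<close> does. Hence, along such perturbations that stay in the box, \<open>xbar\<close> is a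
  local minimum of \<open>f\<close> alone, and since the box is convex the usual variational inequality
  \<open>\<integral> g h \<ge> 0\<close> holds for every \<open>h\<close> that vanishes where \<open>xbar\<close> does and for which \<open>xbar + h\<close> is
  feasible (lemma \<open>derivative_nonneg_on_support_preserving_direction\<close>).

  A single test direction yields all three conclusions: on \<open>{xbar \<noteq> 0}\<close> let \<open>h\<close> be the projected
  gradient step, that is \<open>-g\<close> clipped to the interval \<open>[x\<^sub>a - xbar, x\<^sub>b - xbar]\<close>, and let \<open>h = 0\<close>
  elsewhere. This interval contains \<open>0\<close>, so \<open>h\<close> never has the same sign as \<open>g\<close>, whence
  \<open>g h \<le> 0\<close>. With the variational inequality, \<open>g h = 0\<close> almost everywhere. But the clipping
  annihilates a nonzero \<open>-g\<close> only if \<open>-g\<close> points out of the box, which leaves exactly the sign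
  conditions on \<open>g\<close>; the points with \<open>xbar = x\<^sub>a\<close> or \<open>xbar = x\<^sub>b\<close> lie in \<open>{xbar \<noteq> 0}\<close>
  because \<open>x\<^sub>a < 0 < x\<^sub>b\<close>.
\<close>

lemma L2_scale:
  assumes "h \<in> L2 D"
  shows "(\<lambda>\<omega>. t * h \<omega>) \<in> L2 D"
  using assms unfolding L2_def by (auto simp: power_mult_distrib)

lemma norm_L2_scale: "norm_L2 D (\<lambda>\<omega>. t * h \<omega>) = \<bar>t\<bar> * norm_L2 D h"
  unfolding norm_L2_def by (simp add: power_mult_distrib real_sqrt_mult)

lemma norm_L2_nonneg: "0 \<le> norm_L2 D h"
  unfolding norm_L2_def by simp

lemma L2_dominated:
  assumes "g \<in> L2 D" and "h \<in> borel_measurable (lebesgue_on D)"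
    and "AE \<omega> in lebesgue_on D. \<bar>h \<omega>\<bar> \<le> \<bar>g \<omega>\<bar>"
  shows "h \<in> L2 D"
proof -
  have "integrable (lebesgue_on D) (\<lambda>\<omega>. (h \<omega>)\<^sup>2)"
  proof (rule Bochner_Integration.integrable_bound)
    show "integrable (lebesgue_on D) (\<lambda>\<omega>. (g \<omega>)\<^sup>2)"
      using assms(1) by (simp add: L2_def)
    show "(\<lambda>\<omega>. (h \<omega>)\<^sup>2) \<in> borel_measurable (lebesgue_on D)"
      using assms(2) by measurable
    show "AE \<omega> in lebesgue_on D. norm ((h \<omega>)\<^sup>2) \<le> norm ((g \<omega>)\<^sup>2)"
      using assms(3) by eventually_elim (simp add: abs_le_square_iff)
  qed
  then show ?thesis
    using assms(2) by (simp add: L2_def)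
qed

lemma L2_add:
  assumes "x \<in> L2 D" and "h \<in> L2 D"
  shows "(\<lambda>\<omega>. x \<omega> + h \<omega>) \<in> L2 D"
proof -
  have meas: "x \<in> borel_measurable (lebesgue_on D)" "h \<in> borel_measurable (lebesgue_on D)"
    using assms by (simp_all add: L2_def)
  have "integrable (lebesgue_on D) (\<lambda>\<omega>. (x \<omega> + h \<omega>)\<^sup>2)"
  proof (rule Bochner_Integration.integrable_bound)
    show "integrable (lebesgue_on D) (\<lambda>\<omega>. 2 * (x \<omega>)\<^sup>2 + 2 * (h \<omega>)\<^sup>2)"
      using assms by (simp add: L2_def)
    show "(\<lambda>\<omega>. (x \<omega> + h \<omega>)\<^sup>2) \<in> borel_measurable (lebesgue_on D)"
      using meas by measurable
    have "(a + b)\<^sup>2 \<le> 2 * a\<^sup>2 + 2 * b\<^sup>2" for a b :: real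
      using zero_le_power2[of "a - b"] by (simp add: power2_eq_square algebra_simps)
    then show "AE \<omega> in lebesgue_on D.
        norm ((x \<omega> + h \<omega>)\<^sup>2) \<le> norm (2 * (x \<omega>)\<^sup>2 + 2 * (h \<omega>)\<^sup>2)"
      by (intro AE_I2) simp
  qed
  then show ?thesis
    using meas by (simp add: L2_def)
qed

lemma L2_mult_integrable:
  assumes "g \<in> L2 D" and "h \<in> L2 D"
  shows "integrable (lebesgue_on D) (\<lambda>\<omega>. g \<omega> * h \<omega>)"
proof (rule Bochner_Integration.integrable_bound)
  show "integrable (lebesgue_on D) (\<lambda>\<omega>. (g \<omega>)\<^sup>2 + (h \<omega>)\<^sup>2)"
    using assms by (simp add: L2_def)
  show "(\<lambda>\<omega>. g \<omega> * h \<omega>) \<in> borel_measurable (lebesgue_on D)"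
    using assms by (auto simp: L2_def intro: borel_measurable_times)
  have "\<bar>a * b\<bar> \<le> a\<^sup>2 + b\<^sup>2" for a b :: real
    using sum_squares_bound[of "\<bar>a\<bar>" "\<bar>b\<bar>"] abs_ge_zero[of "a * b"]
    unfolding abs_mult power2_abs by linarith
  then show "AE \<omega> in lebesgue_on D. norm (g \<omega> * h \<omega>) \<le> norm ((g \<omega>)\<^sup>2 + (h \<omega>)\<^sup>2)"
    by (intro AE_I2) simp
qed

text \<open>If the slope \<open>l h\<close> were negative, the remainder of the expansion of \<open>f\<close> along \<open>t h\<close> would for
  small \<open>t\<close> be at most half of \<open>t \<bar>l h\<bar>\<close>, and \<open>f\<close> would strictly decrease.\<close>

lemma has_L2_derivative_nonneg:
  assumes deriv: "has_L2_derivative D f l x" and h: "h \<in> L2 D"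
    and "\<tau> > 0" and min: "\<And>t. 0 < t \<Longrightarrow> t < \<tau> \<Longrightarrow> f x \<le> f (\<lambda>\<omega>. x \<omega> + t * h \<omega>)"
  shows "0 \<le> l h"
proof (rule ccontr)
  assume "\<not> 0 \<le> l h"
  \<comment> \<open>The summand 1 keeps the denominators below positive when \<open>h\<close> vanishes almost everywhere.\<close>
  define n where "n = norm_L2 D h + 1"
  define \<epsilon> where "\<epsilon> = - l h / (2 * n)"
  have n: "n > 0" "norm_L2 D h < n"
    using norm_L2_nonneg[of D h] by (simp_all add: n_def)
  have "\<epsilon> > 0"
    using \<open>\<not> 0 \<le> l h\<close> n by (simp add: \<epsilon>_def divide_neg_pos)
  then obtain \<delta> where "\<delta> > 0"
    and \<delta>: "\<And>k. k \<in> L2 D \<Longrightarrow> norm_L2 D k < \<delta> \<Longrightarrow>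
      \<bar>f (\<lambda>\<omega>. x \<omega> + k \<omega>) - f x - l k\<bar> \<le> \<epsilon> * norm_L2 D k"
    using deriv unfolding has_L2_derivative_def by blast
  define t where "t = min (\<tau> / 2) (\<delta> / n)"
  have t: "0 < t" "t < \<tau>" "t \<le> \<delta> / n"
    using \<open>\<tau> > 0\<close> \<open>\<delta> > 0\<close> n by (auto simp: t_def)
  have "t * norm_L2 D h < t * n"
    using t n by simp
  also have "t * n \<le> \<delta>"
    using t n by (simp add: pos_le_divide_eq)
  finally have small: "norm_L2 D (\<lambda>\<omega>. t * h \<omega>) < \<delta>"
    using t by (simp add: norm_L2_scale)
  have "l (\<lambda>\<omega>. t * h \<omega>) = t * l h"
    using deriv h unfolding has_L2_derivative_def dual_L2_def by blast
  with \<delta>[OF L2_scale[OF h] small]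
  have "f (\<lambda>\<omega>. x \<omega> + t * h \<omega>) - f x \<le> t * l h + \<epsilon> * (t * norm_L2 D h)"
    using t by (simp add: norm_L2_scale)
  also have "\<dots> \<le> t * l h + \<epsilon> * (t * n)"
    using t n \<open>\<epsilon> > 0\<close> by simp
  also have "\<dots> = t * l h / 2"
    using n by (simp add: \<epsilon>_def field_simps)
  also have "\<dots> < 0"
    using t \<open>\<not> 0 \<le> l h\<close> by (simp add: mult_pos_neg)
  finally show False
    using min[OF t(1,2)] by simp
qed

lemma L2_box_segment:
  assumes x: "x \<in> L2_box D a b" and h: "h \<in> L2 D"
    and xh: "(\<lambda>\<omega>. x \<omega> + h \<omega>) \<in> L2_box D a b" and t: "0 \<le> t" "t \<le> 1"
  shows "(\<lambda>\<omega>. x \<omega> + t * h \<omega>) \<in> L2_box D a b"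
proof -
  have conv: "lo \<le> u + t * v \<and> u + t * v \<le> hi"
    if "lo \<le> u" "u \<le> hi" "lo \<le> u + v" "u + v \<le> hi" for lo hi u v :: real
  proof -
    have "u + t * v = (1 - t) * u + t * (u + v)"
      by (simp add: algebra_simps)
    moreover have "(1 - t) * lo + t * lo \<le> (1 - t) * u + t * (u + v)"
      using that t by (intro add_mono mult_left_mono) auto
    moreover have "(1 - t) * u + t * (u + v) \<le> (1 - t) * hi + t * hi"
      using that t by (intro add_mono mult_left_mono) auto
    ultimately show ?thesis
      by (simp add: algebra_simps)
  qed
  have "AE \<omega> in lebesgue_on D. a \<omega> \<le> x \<omega> \<and> x \<omega> \<le> b \<omega>"
    and "AE \<omega> in lebesgue_on D. a \<omega> \<le> x \<omega> + h \<omega> \<and> x \<omega> + h \<omega> \<le> b \<omega>"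
    using x xh by (simp_all add: L2_box_def)
  then have "AE \<omega> in lebesgue_on D. a \<omega> \<le> x \<omega> + t * h \<omega> \<and> x \<omega> + t * h \<omega> \<le> b \<omega>"
    by eventually_elim (use conv in blast)
  moreover have "(\<lambda>\<omega>. x \<omega> + t * h \<omega>) \<in> L2 D"
    using x h by (auto simp: L2_box_def intro: L2_add L2_scale)
  ultimately show ?thesis
    by (simp add: L2_box_def)
qed

text \<open>Boundedness of \<open>D\<close> keeps the volumes finite: the real-valued measure is 0 on a set of infinite
  volume, which would break monotonicity.\<close>

lemma support_measure_mono:
  assumes "bounded D" and D: "D \<in> sets lebesgue"
    and x: "x \<in> borel_measurable (lebesgue_on D)" and y: "y \<in> borel_measurable (lebesgue_on D)"
    and sub: "\<And>\<omega>. \<omega> \<in> D \<Longrightarrow> x \<omega> = 0 \<Longrightarrow> y \<omega> = 0"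
  shows "support_measure D y \<le> support_measure D x"
proof -
  have supp: "{\<omega> \<in> D. z \<omega> \<noteq> 0} \<in> sets lebesgue"
    if z: "z \<in> borel_measurable (lebesgue_on D)" for z :: "'a \<Rightarrow> real"
  proof -
    have "{\<omega> \<in> space (lebesgue_on D). z \<omega> \<noteq> 0} \<in> sets (lebesgue_on D)"
      using z by measurable
    then show ?thesis
      using D by (simp add: sets_restrict_space_iff)
  qed
  have "bounded {\<omega> \<in> D. x \<omega> \<noteq> 0}"
    using \<open>bounded D\<close> by (rule bounded_subset) auto
  then have "{\<omega> \<in> D. x \<omega> \<noteq> 0} \<in> lmeasurable"
    using supp[OF x] by (rule bounded_set_imp_lmeasurable)
  then show ?thesis
    unfolding support_measure_def
    using sub supp[OF y] by (intro measure_mono_fmeasurable) auto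
qed

text \<open>The variational inequality: along \<open>t h\<close> the support term does not increase and the box is not
  left, so the local minimality of the sum passes to \<open>f\<close> itself.\<close>

lemma derivative_nonneg_on_support_preserving_direction:
  assumes D: "bounded D" "D \<in> sets lebesgue"
    and min: "local_min_L2 D (\<lambda>x. f x + support_measure D x) (L2_box D a b) x"
    and deriv: "has_L2_derivative D f l x"
    and h: "h \<in> L2 D" and supp: "\<And>\<omega>. \<omega> \<in> D \<Longrightarrow> x \<omega> = 0 \<Longrightarrow> h \<omega> = 0"
    and xh: "(\<lambda>\<omega>. x \<omega> + h \<omega>) \<in> L2_box D a b"
  shows "0 \<le> l h"
proof -
  obtain \<epsilon> where x: "x \<in> L2_box D a b" and "\<epsilon> > 0"
    and \<epsilon>: "\<And>y. y \<in> L2_box D a b \<Longrightarrow> norm_L2 D (\<lambda>\<omega>. y \<omega> - x \<omega>) < \<epsilon> \<Longrightarrow>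
      f x + support_measure D x \<le> f y + support_measure D y"
    using min unfolding local_min_L2_def by blast
  define n where "n = norm_L2 D h + 1"
  have n: "n > 0" "norm_L2 D h < n"
    using norm_L2_nonneg[of D h] by (simp_all add: n_def)
  show ?thesis
  proof (rule has_L2_derivative_nonneg[OF deriv h])
    show "min 1 (\<epsilon> / n) > 0"
      using \<open>\<epsilon> > 0\<close> n by simp
  next
    fix t :: real
    assume t: "0 < t" "t < min 1 (\<epsilon> / n)"
    let ?y = "\<lambda>\<omega>. x \<omega> + t * h \<omega>"
    have y: "?y \<in> L2_box D a b"
      using t by (intro L2_box_segment[OF x h xh]) auto
    have "t * norm_L2 D h < t * n"
      using t n by simp
    also have "\<dots> < \<epsilon>"
      using t n by (simp add: pos_less_divide_eq)
    finally have "norm_L2 D (\<lambda>\<omega>. ?y \<omega> - x \<omega>) < \<epsilon>"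
      using t by (simp add: norm_L2_scale)
    then have "f x + support_measure D x \<le> f ?y + support_measure D ?y"
      by (rule \<epsilon>[OF y])
    moreover have "support_measure D ?y \<le> support_measure D x"
      using x y supp by (intro support_measure_mono[OF D]) (auto simp: L2_box_def L2_def)
    ultimately show "f x \<le> f ?y"
      by simp
  qed
qed

theorem theorem8p4:
  fixes D :: "'a::euclidean_space set"
    and f :: "('a \<Rightarrow> real) \<Rightarrow> real"
    and x\<^sub>a x\<^sub>b xbar g :: "'a \<Rightarrow> real"
  assumes "D \<noteq> {}" and "bounded D" and "open D"
    and "functional_on_L2 D f"
    and "continuously_differentiable_L2 D f"
    and "x\<^sub>a \<in> L2 D" and "x\<^sub>b \<in> L2 D"
    and "AE \<omega> in lebesgue_on D. x\<^sub>a \<omega> < 0 \<and> 0 < x\<^sub>b \<omega>"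
    and "xbar \<in> L2 D"
    and "local_min_L2 D (\<lambda>x. f x + support_measure D x) (L2_box D x\<^sub>a x\<^sub>b) xbar"
    and "g \<in> L2 D" and "has_L2_derivative D f (L2_to_dual D g) xbar"
  shows "(AE \<omega> in lebesgue_on D.
            xbar \<omega> \<noteq> 0 \<and> x\<^sub>a \<omega> < xbar \<omega> \<and> xbar \<omega> < x\<^sub>b \<omega> \<longrightarrow> g \<omega> = 0) \<and>
         (AE \<omega> in lebesgue_on D. xbar \<omega> = x\<^sub>a \<omega> \<longrightarrow> g \<omega> \<ge> 0) \<and>
         (AE \<omega> in lebesgue_on D. xbar \<omega> = x\<^sub>b \<omega> \<longrightarrow> g \<omega> \<le> 0)"
proof -
  note D = \<open>bounded D\<close> lmeasurable_open[OF \<open>bounded D\<close> \<open>open D\<close>, THEN fmeasurableD]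
  have meas [measurable]: "x\<^sub>a \<in> borel_measurable (lebesgue_on D)"
    "x\<^sub>b \<in> borel_measurable (lebesgue_on D)" "xbar \<in> borel_measurable (lebesgue_on D)"
    "g \<in> borel_measurable (lebesgue_on D)"
    using assms(6,7,9,11) by (simp_all add: L2_def)
  have feas: "AE \<omega> in lebesgue_on D. x\<^sub>a \<omega> \<le> xbar \<omega> \<and> xbar \<omega> \<le> x\<^sub>b \<omega>"
    using assms(10) by (simp add: local_min_L2_def L2_box_def)
  define h where "h = (\<lambda>\<omega>. if xbar \<omega> = 0 then 0
    else max (x\<^sub>a \<omega> - xbar \<omega>) (min (x\<^sub>b \<omega> - xbar \<omega>) (- g \<omega>)))"
  have [measurable]: "h \<in> borel_measurable (lebesgue_on D)"
    unfolding h_def by measurable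
  have "AE \<omega> in lebesgue_on D. \<bar>h \<omega>\<bar> \<le> \<bar>g \<omega>\<bar>"
    using feas by eventually_elim (auto simp: h_def)
  then have h: "h \<in> L2 D"
    by (rule L2_dominated[OF assms(11), rotated]) measurable
  have "AE \<omega> in lebesgue_on D. x\<^sub>a \<omega> \<le> xbar \<omega> + h \<omega> \<and> xbar \<omega> + h \<omega> \<le> x\<^sub>b \<omega>"
    using feas by eventually_elim (auto simp: h_def)
  then have "(\<lambda>\<omega>. xbar \<omega> + h \<omega>) \<in> L2_box D x\<^sub>a x\<^sub>b"
    using L2_add[OF assms(9) h] by (simp add: L2_box_def)
  then have "0 \<le> L2_to_dual D g h"
    by (intro derivative_nonneg_on_support_preserving_direction[OF D assms(10,12) h])
      (simp_all add: h_def)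
  then have "(LINT \<omega>|lebesgue_on D. - (g \<omega> * h \<omega>)) \<le> 0"
    by (simp add: L2_to_dual_def)
  moreover have int: "integrable (lebesgue_on D) (\<lambda>\<omega>. - (g \<omega> * h \<omega>))"
    using L2_mult_integrable[OF assms(11) h] by simp
  moreover have sign: "AE \<omega> in lebesgue_on D. 0 \<le> - (g \<omega> * h \<omega>)"
    using feas
  proof eventually_elim
    case (elim \<omega>)
    then have "(0 \<le> g \<omega> \<and> h \<omega> \<le> 0) \<or> (g \<omega> \<le> 0 \<and> 0 \<le> h \<omega>)"
      by (auto simp: h_def)
    then show ?case
      by (auto simp: mult_nonneg_nonpos mult_nonpos_nonneg)
  qed
  ultimately have "(LINT \<omega>|lebesgue_on D. - (g \<omega> * h \<omega>)) = 0"
    using integral_nonneg_AE[OF sign] by linarith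
  then have "AE \<omega> in lebesgue_on D. - (g \<omega> * h \<omega>) = 0"
    using integral_nonneg_eq_0_iff_AE[OF int sign] by blast
  then have "AE \<omega> in lebesgue_on D.
      (xbar \<omega> \<noteq> 0 \<and> x\<^sub>a \<omega> < xbar \<omega> \<and> xbar \<omega> < x\<^sub>b \<omega> \<longrightarrow> g \<omega> = 0) \<and>
      (xbar \<omega> = x\<^sub>a \<omega> \<longrightarrow> g \<omega> \<ge> 0) \<and> (xbar \<omega> = x\<^sub>b \<omega> \<longrightarrow> g \<omega> \<le> 0)"
    using assms(8) feas
  proof eventually_elim
    case (elim \<omega>)
    then have "g \<omega> = 0 \<or> h \<omega> = 0"
      by simp
    with elim(2,3) show ?case
      by (auto simp: h_def max_def min_def split: if_splits)
  qed
  then show ?thesis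
    by (auto elim: eventually_mono)
qed

end
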